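(* Let $k$ be a field and $R=k[x_1,x_2]/(x_1^2,x_1x_2,x_2^2)$. Let $V_*$ be the complex of free $R$-modules obtained by applying the Chain Complex Construction Procedure to $R$ with initial map $R\xrightarrow{x_1}R$. Then, with the vertices (basis elements) in each degree suitably ordered, $V_0=R$, $V_n=\bigoplus_{i=1}^{2^{n-1}}R$ for $n\ge 1$, and the differential $\partial_n:V_n\to V_{n-1}$ is given by $$\partial_1=\begin{bmatrix}x_1\end{bmatrix},\qquad \partial_2=\begin{bmatrix}x_1&x_2\end{bmatrix},\qquad \partial_n=\begin{bmatrix}\partial_{n-1}&0\\0&\partial_{n-1}\end{bmatrix}\quad(n\ge 3).$$ Moreover $V_*$ is a free resolution of the $R$-module $R/(x_1)$; that is, $\cdots\to V_2\xrightarrow{\partial_2}V_1\xrightarrow{\partial_1}V_0\to R/(x_1)\to 0$ is an exact sequence, where $V_0=R\to R/(x_1)$ is the canonical projection.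
   Context: **The procedure for this ring.** Write $I=(x_1^2,x_1x_2,x_2^2)$. The Chain Complex Construction Procedure builds a graded diagram of vertices in degrees $d\ge 0$ and arrows, labelled by indices in $\{1,2\}$, from degree $d+1$ to degree $d$. Since every product $x_ix_j$ lies in $I$, only the "column completion" rule of the procedure occurs, and the procedure reads as follows. Start with one vertex in degree $0$, one vertex in degree $1$, and one arrow from the latter to the former with label $1$. Given the arrows from degree $d+1$ to degree $d$ ($d\ge 0$), the vertices of degree $d+2$ and arrows from degree $d+2$ to degree $d+1$ are obtained as follows: for every arrow $v\to w$ with label $i$ from degree $d+1$ to degree $d$, and every $j$ with $x_ix_j\in I$ (here $j=1,2$), add a new vertex $u$ of degree $d+2$ and an arrow $u\to v$ with label $j$. Repeat indefinitely. The complex $V_*$ has in degree $d$ the free $R$-module with basis the vertices of degree $d$ (and $0$ for $d<0$), and the component of the differential from the copy of $R$ at $v$ to the copy of $R$ at $w$ is multiplication by $x_i$ if there is an arrow $v\to w$ with label $i$, and $0$ otherwise. *)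

theory Defs
  imports
    "HOL-Algebra.Algebraic_Closure_Type"
    "HOL-Algebra.QuotRing"
    "HOL-Algebra.Module"
    "Jordan_Normal_Form.Matrix"
begin

text \<open>As for the modules of vectors in \<^theory>\<open>Jordan_Normal_Form.Matrix\<close>, the multiplicative
  fields of a module record carry no information and are left undefined where there is no
  natural choice.\<close>

definition module_homs ::
  "('r, 'p) ring_scheme \<Rightarrow> ('r, 'a, 'q) module_scheme \<Rightarrow> ('r, 'b, 's) module_scheme \<Rightarrow> ('a \<Rightarrow> 'b) set"
where
  "module_homs R M N = {h \<in> carrier M \<rightarrow> carrier N.
     (\<forall>x \<in> carrier M. \<forall>y \<in> carrier M. h (x \<oplus>\<^bsub>M\<^esub> y) = h x \<oplus>\<^bsub>N\<^esub> h y) \<and>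
     (\<forall>a \<in> carrier R. \<forall>x \<in> carrier M. h (a \<odot>\<^bsub>M\<^esub> x) = a \<odot>\<^bsub>N\<^esub> h x)}"

definition module_isos ::
  "('r, 'p) ring_scheme \<Rightarrow> ('r, 'a, 'q) module_scheme \<Rightarrow> ('r, 'b, 's) module_scheme \<Rightarrow> ('a \<Rightarrow> 'b) set"
where
  "module_isos R M N = {h \<in> module_homs R M N. bij_betw h (carrier M) (carrier N)}"

definition regular_module :: "('r, 'p) ring_scheme \<Rightarrow> ('r, 'r) module" where
  "regular_module R = \<lparr>carrier = carrier R, monoid.mult = (\<otimes>\<^bsub>R\<^esub>), one = one R,
     zero = zero R, add = add R, module.smult = (\<otimes>\<^bsub>R\<^esub>)\<rparr>"

definition free_on :: "('r, 'p) ring_scheme \<Rightarrow> 'b set \<Rightarrow> ('r, 'b \<Rightarrow> 'r) module" where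
  "free_on R A =
     \<lparr>carrier = {f \<in> A \<rightarrow>\<^sub>E carrier R. finite {a \<in> A. f a \<noteq> \<zero>\<^bsub>R\<^esub>}},
      monoid.mult = undefined, one = undefined,
      zero = (\<lambda>a\<in>A. \<zero>\<^bsub>R\<^esub>),
      add = (\<lambda>f g. \<lambda>a\<in>A. f a \<oplus>\<^bsub>R\<^esub> g a),
      module.smult = (\<lambda>r f. \<lambda>a\<in>A. r \<otimes>\<^bsub>R\<^esub> f a)\<rparr>"

definition basis_vec :: "('r, 'p) ring_scheme \<Rightarrow> 'b set \<Rightarrow> 'b \<Rightarrow> 'b \<Rightarrow> 'r" where
  "basis_vec R A a = (\<lambda>b\<in>A. if b = a then \<one>\<^bsub>R\<^esub> else \<zero>\<^bsub>R\<^esub>)"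

text \<open>In \<open>matrix_of\<close>, the list \<open>ws\<close> orders the standard basis of the target and \<open>vs\<close> that of the
  source.\<close>

definition matrix_of ::
  "('r, 'p) ring_scheme \<Rightarrow> 'b list \<Rightarrow> 'c list \<Rightarrow> (('c \<Rightarrow> 'r) \<Rightarrow> ('b \<Rightarrow> 'r)) \<Rightarrow> 'r mat" where
  "matrix_of R ws vs h =
     mat (length ws) (length vs) (\<lambda>(i, j). h (basis_vec R (set vs) (vs ! j)) (ws ! i))"

definition zero_matrix :: "('r, 'p) ring_scheme \<Rightarrow> nat \<Rightarrow> nat \<Rightarrow> 'r mat" where
  "zero_matrix R m n = mat m n (\<lambda>_. \<zero>\<^bsub>R\<^esub>)"

definition free_module :: "('r, 'p) ring_scheme \<Rightarrow> ('r, 'a, 'q) module_scheme \<Rightarrow> bool" where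
  "free_module R M \<longleftrightarrow> Module.module R M \<and>
     (\<exists>B \<subseteq> carrier M. \<forall>m \<in> carrier M. \<exists>!c. c \<in> B \<rightarrow>\<^sub>E carrier R \<and>
        finite {b \<in> B. c b \<noteq> \<zero>\<^bsub>R\<^esub>} \<and>
        m = (\<Oplus>\<^bsub>M\<^esub>b \<in> {b \<in> B. c b \<noteq> \<zero>\<^bsub>R\<^esub>}. c b \<odot>\<^bsub>M\<^esub> b))"

text \<open>\<open>d n\<close> goes from degree \<open>n\<close> to degree \<open>n - 1\<close>, so \<open>d 0\<close> is irrelevant; the degree-zero
  module is augmented by \<open>eps\<close>.\<close>

definition free_resolution ::
  "('r, 'p) ring_scheme \<Rightarrow> (nat \<Rightarrow> ('r, 'a, 'q) module_scheme) \<Rightarrow> (nat \<Rightarrow> 'a \<Rightarrow> 'a)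
     \<Rightarrow> ('r, 'b, 's) module_scheme \<Rightarrow> ('a \<Rightarrow> 'b) \<Rightarrow> bool"
where
  "free_resolution R V d M eps \<longleftrightarrow>
     Module.module R M \<and>
     (\<forall>n. free_module R (V n)) \<and>
     (\<forall>n\<ge>1. d n \<in> module_homs R (V n) (V (n - 1))) \<and>
     eps \<in> module_homs R (V 0) M \<and>
     eps ` carrier (V 0) = carrier M \<and>
     d 1 ` carrier (V 1) = a_kernel (V 0) M eps \<and>
     (\<forall>n\<ge>1. d (n + 1) ` carrier (V (n + 1)) = a_kernel (V n) (V (n - 1)) (d n))"

text \<open>The scalar action is multiplication in \<open>R/J\<close> restricted along \<open>R \<rightarrow> R/J\<close>.\<close>

definition quotient_module :: "('r, 'p) ring_scheme \<Rightarrow> 'r set \<Rightarrow> ('r, 'r set) module" where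
  "quotient_module R J =
     \<lparr>carrier = carrier (R Quot J), monoid.mult = monoid.mult (R Quot J), one = one (R Quot J),
      zero = zero (R Quot J), add = add (R Quot J),
      module.smult = (\<lambda>a S. (J +>\<^bsub>R\<^esub> a) \<otimes>\<^bsub>R Quot J\<^esub> S)\<rparr>"

text \<open>\<open>New a j\<close> is the vertex added for the arrow \<open>a\<close> and the label \<open>j\<close>; thus different pairs
  \<open>(a, j)\<close> add different vertices. An arrow is a triple (source, target, label).\<close>

datatype vertex = Bottom | Initial | New "vertex \<times> vertex \<times> nat" nat

type_synonym arrow = "vertex \<times> vertex \<times> nat"

text \<open>\<open>arrows I x d\<close> are the arrows from degree \<open>d + 1\<close> to degree \<open>d\<close>. This is the procedure
  in the case where all products \<open>x\<^sub>i x\<^sub>j\<close> with \<open>i, j \<in> {1, 2}\<close> lie in \<open>I\<close>, when column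
  completion is its only applicable rule.\<close>

primrec arrows :: "'a::times set \<Rightarrow> (nat \<Rightarrow> 'a) \<Rightarrow> nat \<Rightarrow> arrow set" where
  "arrows I x 0 = {(Initial, Bottom, 1)}"
| "arrows I x (Suc d) = {(New (v, w, i) j, v, j) | v w i j.
     (v, w, i) \<in> arrows I x d \<and> j \<in> {1, 2} \<and> x i * x j \<in> I}"

fun vertices :: "'a::times set \<Rightarrow> (nat \<Rightarrow> 'a) \<Rightarrow> nat \<Rightarrow> vertex set" where
  "vertices I x 0 = {Bottom}"
| "vertices I x (Suc 0) = {Initial}"
| "vertices I x (Suc (Suc d)) = {New (v, w, i) j | v w i j.
     (v, w, i) \<in> arrows I x d \<and> j \<in> {1, 2} \<and> x i * x j \<in> I}"

text \<open>\<open>k[x\<^sub>1, x\<^sub>2]\<close> is \<open>k[x\<^sub>1][x\<^sub>2]\<close>: the inner polynomial variable is \<open>x\<^sub>1\<close>, the outer one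
  \<open>x\<^sub>2\<close>.\<close>

definition xvar :: "nat \<Rightarrow> 'k::field poly poly" where
  "xvar i = (if i = 1 then [:[:0, 1:]:] else [:0, 1:])"

definition poly_ring2 :: "'k::field itself \<Rightarrow> 'k poly poly ring" where
  "poly_ring2 K = ring_of_type_algebra"

definition rel_ideal :: "'k::field itself \<Rightarrow> 'k poly poly set" where
  "rel_ideal K = Idl\<^bsub>poly_ring2 K\<^esub> {xvar 1 ^ 2, xvar 1 * xvar 2, xvar 2 ^ 2}"

definition R_ring :: "'k::field itself \<Rightarrow> 'k poly poly set ring" where
  "R_ring K = poly_ring2 K Quot rel_ideal K"

definition xbar :: "'k::field itself \<Rightarrow> nat \<Rightarrow> 'k poly poly set" where
  "xbar K i = rel_ideal K +>\<^bsub>poly_ring2 K\<^esub> xvar i"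

definition verts :: "'k::field itself \<Rightarrow> nat \<Rightarrow> vertex set" where
  "verts K n = vertices (rel_ideal K) xvar n"

definition V :: "'k::field itself \<Rightarrow> nat \<Rightarrow> ('k poly poly set, vertex \<Rightarrow> 'k poly poly set) module" where
  "V K n = free_on (R_ring K) (verts K n)"

text \<open>The component of the differential from the copy of \<open>R\<close> at \<open>v\<close> (in degree \<open>d + 1\<close>) to the
  copy at \<open>w\<close> (in degree \<open>d\<close>). There is at most one arrow from \<open>v\<close> to \<open>w\<close>, so the label is
  well defined.\<close>

definition component :: "'k::field itself \<Rightarrow> nat \<Rightarrow> vertex \<Rightarrow> vertex \<Rightarrow> 'k poly poly set" where
  "component K d v w =
     (if \<exists>i. (v, w, i) \<in> arrows (rel_ideal K) xvar d
      then xbar K (THE i. (v, w, i) \<in> arrows (rel_ideal K) xvar d)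
      else \<zero>\<^bsub>R_ring K\<^esub>)"

text \<open>From degree \<open>n\<close> to degree \<open>n - 1\<close>; only meaningful for \<open>n \<ge> 1\<close>.\<close>

definition bd :: "'k::field itself \<Rightarrow> nat \<Rightarrow> (vertex \<Rightarrow> 'k poly poly set) \<Rightarrow> vertex \<Rightarrow> 'k poly poly set" where
  "bd K n f = (\<lambda>w \<in> verts K (n - 1).
     \<Oplus>\<^bsub>R_ring K\<^esub>v \<in> verts K n. component K (n - 1) v w \<otimes>\<^bsub>R_ring K\<^esub> f v)"

definition x1_ideal :: "'k::field itself \<Rightarrow> 'k poly poly set set" where
  "x1_ideal K = Idl\<^bsub>R_ring K\<^esub> {xbar K 1}"

text \<open>The canonical projection, read on the free module with the one basis element \<open>Bottom\<close>.\<close>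

definition proj :: "'k::field itself \<Rightarrow> (vertex \<Rightarrow> 'k poly poly set) \<Rightarrow> 'k poly poly set set" where
  "proj K f = x1_ideal K +>\<^bsub>R_ring K\<^esub> f Bottom"

end

theory Submission
  imports Defs
begin

text \<open>
  Two observations prove the theorem.

  On the combinatorial side, every vertex \<open>v\<close> of positive degree has a single outgoing arrow, and
  in degrees \<open>\<ge> 1\<close> it receives exactly two new vertices, one for each label (\<open>verts_Suc_Suc\<close>), since
  all products \<open>x\<^sub>i x\<^sub>j\<close> are relations. So the vertices of positive degree form the complete binary
  tree. If every level is ordered so that the two children of the \<open>i\<close>-th vertex stand at the
  positions \<open>2i\<close> and \<open>2i + 1\<close>, then the matrix of \<open>\<partial>\<^sub>n\<close> for \<open>n \<ge> 2\<close> is block diagonal with blocks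
  \<open>[x\<^sub>1 x\<^sub>2]\<close> (\<open>bd_matrix_Suc_Suc\<close>), and a block diagonal matrix with \<open>2\<^sup>k\<^sup>+\<^sup>1\<close> equal blocks consists of two
  copies of the one with \<open>2\<^sup>k\<close> blocks (\<open>bd_matrix_block\<close>).

  On the algebraic side, let \<open>\<mm> = (x\<^sub>1, x\<^sub>2)\<close>. An element of \<open>R\<close> is determined by its coefficients at
  \<open>1\<close>, \<open>x\<^sub>1\<close> and \<open>x\<^sub>2\<close> (\<open>rel_ideal_iff\<close>). Comparing the last two shows that \<open>x\<^sub>1a + x\<^sub>2b = 0\<close> holds exactly
  when \<open>a, b \<in> \<mm>\<close> (\<open>syzygy_iff\<close>), and in particular \<open>x\<^sub>1a = 0\<close> exactly when \<open>a \<in> \<mm>\<close>. As each row of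
  \<open>\<partial>\<^sub>n\<close> involves its own columns, the kernel of \<open>\<partial>\<^sub>n\<close> is \<open>\<mm>V\<^sub>n\<close> for every \<open>n \<ge> 1\<close> (\<open>kernel_bd\<close>). The
  image of \<open>\<partial>\<^sub>n\<^sub>+\<^sub>1\<close> is \<open>\<mm>V\<^sub>n\<close> as well (\<open>image_bd\<close>), because each of its entries runs freely through
  the elements \<open>x\<^sub>1a + x\<^sub>2b\<close>. At \<open>V\<^sub>0\<close> both the image of \<open>\<partial>\<^sub>1\<close> and the kernel of the projection are
  \<open>x\<^sub>1R\<close> (\<open>image_bd_1\<close>).
\<close>

section \<open>Free modules on a set\<close>

lemma (in cring) module_free_on: "Module.module R (free_on R A)"
proof (rule moduleI)
  have add_closed: "(\<lambda>a\<in>A. f a \<oplus> g a) \<in> carrier (free_on R A)"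
    if "f \<in> carrier (free_on R A)" "g \<in> carrier (free_on R A)" for f g
  proof -
    have "finite {a \<in> A. (\<lambda>a\<in>A. f a \<oplus> g a) a \<noteq> \<zero>}"
      by (rule finite_subset[of _ "{a \<in> A. f a \<noteq> \<zero>} \<union> {a \<in> A. g a \<noteq> \<zero>}"])
        (use that in \<open>auto simp: free_on_def\<close>)
    then show ?thesis using that by (auto simp: free_on_def)
  qed
  have smult_closed: "(\<lambda>a\<in>A. r \<otimes> f a) \<in> carrier (free_on R A)"
    if "r \<in> carrier R" "f \<in> carrier (free_on R A)" for r f
  proof -
    have "finite {a \<in> A. (\<lambda>a\<in>A. r \<otimes> f a) a \<noteq> \<zero>}"
      by (rule finite_subset[of _ "{a \<in> A. f a \<noteq> \<zero>}"])
        (use that in \<open>auto simp: free_on_def\<close>)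
    then show ?thesis using that by (auto simp: free_on_def)
  qed
  show "cring R" by (rule is_cring)
  show "abelian_group (free_on R A)"
  proof (rule abelian_groupI)
    fix f assume f: "f \<in> carrier (free_on R A)"
    let ?g = "\<lambda>a\<in>A. \<ominus> f a"
    have "finite {a \<in> A. ?g a \<noteq> \<zero>}"
      by (rule finite_subset[of _ "{a \<in> A. f a \<noteq> \<zero>}"])
        (use f in \<open>auto simp: free_on_def\<close>)
    then have "?g \<in> carrier (free_on R A)"
      using f by (auto simp: free_on_def)
    moreover have "?g \<oplus>\<^bsub>free_on R A\<^esub> f = \<zero>\<^bsub>free_on R A\<^esub>"
      using f by (auto simp: free_on_def fun_eq_iff PiE_iff l_neg)
    ultimately show "\<exists>g \<in> carrier (free_on R A). g \<oplus>\<^bsub>free_on R A\<^esub> f = \<zero>\<^bsub>free_on R A\<^esub>"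
      by blast
  next
    show "f \<oplus>\<^bsub>free_on R A\<^esub> g \<in> carrier (free_on R A)"
      if "f \<in> carrier (free_on R A)" "g \<in> carrier (free_on R A)" for f g
      using add_closed[OF that] by (simp add: free_on_def)
  qed (auto simp: free_on_def fun_eq_iff PiE_iff extensional_def a_ac)
  show "r \<odot>\<^bsub>free_on R A\<^esub> f \<in> carrier (free_on R A)"
    if "r \<in> carrier R" "f \<in> carrier (free_on R A)" for r f
    using smult_closed[OF that] by (simp add: free_on_def)
qed (auto simp: free_on_def fun_eq_iff PiE_iff extensional_def l_distr r_distr m_assoc)

text \<open>Evaluation at a point is additive; this turns an identity between a vector and a linear
  combination into identities between coordinates.\<close>

lemma (in cring) finsum_free_on_apply:
  assumes "finite S" and "F \<in> S \<rightarrow> carrier (free_on R A)" and "a \<in> A"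
  shows "(\<Oplus>\<^bsub>free_on R A\<^esub>s \<in> S. F s) a = (\<Oplus>s \<in> S. F s a)"
proof -
  interpret M: Module.module R "free_on R A" by (rule module_free_on)
  have closed: "f a \<in> carrier R" if "f \<in> carrier (free_on R A)" for f
    using that \<open>a \<in> A\<close> by (auto simp: free_on_def)
  show ?thesis
    using assms(1,2)
  proof (induction S)
    case empty
    then show ?case using \<open>a \<in> A\<close> by (simp add: M.M.finsum_empty) (simp add: free_on_def)
  next
    case (insert s S)
    have *: "(f \<oplus>\<^bsub>free_on R A\<^esub> g) a = f a \<oplus> g a" for f g
      using \<open>a \<in> A\<close> by (simp add: free_on_def)
    have "F \<in> S \<rightarrow> carrier (free_on R A)" "F s \<in> carrier (free_on R A)" using insert.prems by auto
    moreover from this have "(\<lambda>s. F s a) \<in> S \<rightarrow> carrier R" "F s a \<in> carrier R"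
      using closed by auto
    ultimately show ?case
      using insert.hyps insert.IH by (simp add: M.M.finsum_insert finsum_insert *)
  qed
qed

lemma (in cring) basis_vec_in_free_on: "a \<in> A \<Longrightarrow> basis_vec R A a \<in> carrier (free_on R A)"
  by (auto simp: basis_vec_def free_on_def intro!: finite_subset[of _ "{a}"])

text \<open>The standard basis vectors form a basis: the coordinate at \<open>a\<close> of a linear combination of
  them is the coefficient of the basis vector at \<open>a\<close>, so a vector determines its coefficients and
  its own entries serve as coefficients. That \<open>\<one> \<noteq> \<zero>\<close> makes different points give different basis
  vectors.\<close>

lemma (in cring) free_module_free_on:
  assumes "\<one> \<noteq> \<zero>"
  shows "free_module R (free_on R A)"
proof -
  let ?M = "free_on R A" and ?e = "basis_vec R A" and ?B = "basis_vec R A ` A"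
  let ?lin = "\<lambda>c. \<Oplus>\<^bsub>?M\<^esub>b \<in> {b \<in> ?B. c b \<noteq> \<zero>}. c b \<odot>\<^bsub>?M\<^esub> b"
  interpret M: Module.module R ?M by (rule module_free_on)
  have B: "?B \<subseteq> carrier ?M" by (auto intro: basis_vec_in_free_on)
  have inj: "inj_on ?e A"
  proof (rule inj_onI)
    fix a b assume ab: "a \<in> A" "b \<in> A" "?e a = ?e b"
    then have "?e a a = ?e b a" by simp
    then show "a = b" using ab assms by (simp add: basis_vec_def split: if_splits)
  qed
  have ext: "f \<in> extensional A" if "f \<in> carrier ?M" for f
    using that by (simp add: free_on_def PiE_def)
  have coord: "?lin c a = c (?e a)"
    if c: "c \<in> ?B \<rightarrow>\<^sub>E carrier R" "finite {b \<in> ?B. c b \<noteq> \<zero>}" and a: "a \<in> A" for c a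
  proof -
    have cB: "c b \<in> carrier R" if "b \<in> ?B" for b using c that by blast
    have "?lin c a = (\<Oplus>b \<in> {b \<in> ?B. c b \<noteq> \<zero>}. (c b \<odot>\<^bsub>?M\<^esub> b) a)"
      using c B a cB by (intro finsum_free_on_apply) auto
    also have "\<dots> = (\<Oplus>b \<in> {b \<in> ?B. c b \<noteq> \<zero>}. if ?e a = b then c b else \<zero>)"
    proof (rule finsum_cong')
      fix b assume "b \<in> {b \<in> ?B. c b \<noteq> \<zero>}"
      then obtain a' where a': "a' \<in> A" "b = ?e a'" by auto
      then have "b a = (if a' = a then \<one> else \<zero>)" using a by (auto simp: basis_vec_def)
      moreover have "?e a = b \<longleftrightarrow> a' = a" using inj a a' by (auto dest: inj_onD)
      ultimately show "(c b \<odot>\<^bsub>?M\<^esub> b) a = (if ?e a = b then c b else \<zero>)"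
        using a cB a' by (auto simp: free_on_def)
    qed (use cB in auto)
    also have "\<dots> = c (?e a)"
    proof (cases "c (?e a) = \<zero>")
      case True
      then have "(\<Oplus>b \<in> {b \<in> ?B. c b \<noteq> \<zero>}. if ?e a = b then c b else \<zero>)
          = (\<Oplus>b \<in> {b \<in> ?B. c b \<noteq> \<zero>}. \<zero>)"
        by (intro finsum_cong') auto
      then show ?thesis using True by simp
    next
      case False
      then show ?thesis using a c cB by (intro finsum_singleton) auto
    qed
    finally show ?thesis .
  qed
  have coords: "\<exists>!c. c \<in> ?B \<rightarrow>\<^sub>E carrier R \<and> finite {b \<in> ?B. c b \<noteq> \<zero>} \<and> m = ?lin c"
    if m: "m \<in> carrier ?M" for m
  proof -
    let ?c = "\<lambda>b\<in>?B. m (the_inv_into A ?e b)"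
    have c_e: "?c (?e a) = m a" if "a \<in> A" for a
      using that inj by (simp add: the_inv_into_f_f)
    have lin_closed: "?lin c \<in> carrier ?M" if "c \<in> ?B \<rightarrow>\<^sub>E carrier R" for c
      using that B by (intro M.M.finsum_closed) blast
    show ?thesis
    proof (intro ex1I conjI)
      show cE: "?c \<in> ?B \<rightarrow>\<^sub>E carrier R"
        using c_e m by (auto simp: free_on_def)
      have "{b \<in> ?B. ?c b \<noteq> \<zero>} = ?e ` {a \<in> A. m a \<noteq> \<zero>}"
        using c_e by (auto dest: inj_onD[OF inj])
      then show fin: "finite {b \<in> ?B. ?c b \<noteq> \<zero>}"
        using m by (simp add: free_on_def)
      show "m = ?lin ?c"
      proof (rule extensionalityI[of _ A])
        show "m a = ?lin ?c a" if "a \<in> A" for a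
          using coord[OF cE fin that] c_e[OF that] by simp
      qed (rule ext[OF m] ext[OF lin_closed[OF cE]])+
    next
      fix c assume c: "c \<in> ?B \<rightarrow>\<^sub>E carrier R \<and> finite {b \<in> ?B. c b \<noteq> \<zero>} \<and> m = ?lin c"
      show "c = ?c"
      proof (rule extensionalityI[of _ ?B])
        fix b assume "b \<in> ?B"
        then obtain a where a: "a \<in> A" "b = ?e a" by blast
        show "c b = ?c b" using coord[of c a] c_e[of a] c a by simp
      qed (use c in \<open>simp_all add: PiE_def\<close>)
    qed
  qed
  show ?thesis
    unfolding free_module_def
    using M.module_axioms B coords by (intro conjI exI[of _ ?B] ballI)
qed

lemma (in cring) free_on_reindex_iso:
  assumes \<phi>: "bij_betw \<phi> B A"
  shows "(\<lambda>f. \<lambda>b\<in>B. f (\<phi> b)) \<in> module_isos R (free_on R A) (free_on R B)"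
proof -
  let ?\<psi> = "inv_into B \<phi>"
  have \<phi>A: "\<phi> b \<in> A" if "b \<in> B" for b using \<phi> that by (auto simp: bij_betw_def)
  have \<psi>: "bij_betw ?\<psi> A B" using \<phi> by (rule bij_betw_inv_into)
  have reindex: "(\<lambda>b\<in>B'. f (\<chi> b)) \<in> carrier (free_on R B')"
    if \<chi>: "bij_betw \<chi> B' A'" and f: "f \<in> carrier (free_on R A')"
    for \<chi> :: "'x \<Rightarrow> 'y" and B' A' f
  proof -
    have "\<chi> ` {b \<in> B'. f (\<chi> b) \<noteq> \<zero>} = {a \<in> A'. f a \<noteq> \<zero>}"
      using \<chi> by (auto simp: bij_betw_def)
    moreover have "inj_on \<chi> {b \<in> B'. f (\<chi> b) \<noteq> \<zero>}"
      using \<chi> by (auto simp: bij_betw_def intro: inj_on_subset)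
    ultimately have "finite {b \<in> B'. f (\<chi> b) \<noteq> \<zero>}"
      using f by (intro finite_imageD[of \<chi>]) (simp_all add: free_on_def)
    moreover have "f (\<chi> b) \<in> carrier R" if "b \<in> B'" for b
      using f \<chi> that by (auto simp: free_on_def bij_betw_def)
    ultimately show ?thesis
      by (auto simp: free_on_def restrict_apply cong: conj_cong)
  qed
  have "bij_betw (\<lambda>f. \<lambda>b\<in>B. f (\<phi> b)) (carrier (free_on R A)) (carrier (free_on R B))"
  proof (rule bij_betw_byWitness[where f' = "\<lambda>g. \<lambda>a\<in>A. g (?\<psi> a)"])
    show "\<forall>f \<in> carrier (free_on R A). (\<lambda>a\<in>A. (\<lambda>b\<in>B. f (\<phi> b)) (?\<psi> a)) = f"
      using \<phi> \<psi> by (auto simp: free_on_def fun_eq_iff PiE_iff extensional_def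
          bij_betw_inv_into_right bij_betw_apply)
    show "\<forall>g \<in> carrier (free_on R B). (\<lambda>b\<in>B. (\<lambda>a\<in>A. g (?\<psi> a)) (\<phi> b)) = g"
      using \<phi> \<phi>A by (auto simp: free_on_def fun_eq_iff PiE_iff extensional_def
          bij_betw_inv_into_left)
  qed (use reindex[OF \<phi>] reindex[OF \<psi>] in blast)+
  moreover have "(\<lambda>f. \<lambda>b\<in>B. f (\<phi> b)) \<in> module_homs R (free_on R A) (free_on R B)"
    using reindex[OF \<phi>] \<phi>A by (auto simp: module_homs_def) (auto simp: free_on_def fun_eq_iff)
  ultimately show ?thesis by (simp add: module_isos_def)
qed

lemma (in cring) free_on_singleton_iso:
  "(\<lambda>f. f a) \<in> module_isos R (free_on R {a}) (regular_module R)"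
proof -
  have "bij_betw (\<lambda>f. f a) (carrier (free_on R {a})) (carrier R)"
    by (rule bij_betw_byWitness[where f' = "\<lambda>r. \<lambda>b\<in>{a}. r"])
      (auto simp: free_on_def fun_eq_iff PiE_iff extensional_def)
  then show ?thesis
    by (auto simp: module_isos_def module_homs_def regular_module_def bij_betw_def)
      (auto simp: free_on_def)
qed

section \<open>Quotients of the ring as modules\<close>

lemma (in ideal) module_quotient_module:
  assumes "cring R"
  shows "Module.module R (quotient_module R I)"
proof -
  interpret cring R by fact
  interpret Q: cring "R Quot I" by (rule quotient_is_cring) fact
  interpret h: ring_hom_ring R "R Quot I" "(+>) I" by (rule rcos_ring_hom_ring)
  show ?thesis
  proof (rule moduleI)
    show "cring R" by fact
    show "abelian_group (quotient_module R I)"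
    proof (rule abelian_groupI)
      fix S assume "S \<in> carrier (quotient_module R I)"
      then show "\<exists>T \<in> carrier (quotient_module R I).
          T \<oplus>\<^bsub>quotient_module R I\<^esub> S = \<zero>\<^bsub>quotient_module R I\<^esub>"
        by (intro bexI[of _ "\<ominus>\<^bsub>R Quot I\<^esub> S"])
          (auto simp: quotient_module_def Q.l_neg)
    qed (auto simp: quotient_module_def Q.a_ac)
  qed (auto simp: quotient_module_def Q.l_distr Q.r_distr Q.m_assoc h.hom_closed)
qed

section \<open>The ring \<open>k[x\<^sub>1, x\<^sub>2]/(x\<^sub>1\<^sup>2, x\<^sub>1x\<^sub>2, x\<^sub>2\<^sup>2)\<close>\<close>

lemma cring_poly_ring2: "cring (poly_ring2 K)"
  unfolding poly_ring2_def by (rule cring_from_type_algebra)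

interpretation P: cring "poly_ring2 K" for K :: "'k::field itself"
  by (rule cring_poly_ring2)

lemma poly_ring2_simps [simp]:
  "carrier (poly_ring2 K) = UNIV" "p \<oplus>\<^bsub>poly_ring2 K\<^esub> r = p + r" "p \<otimes>\<^bsub>poly_ring2 K\<^esub> r = p * r"
  "\<zero>\<^bsub>poly_ring2 K\<^esub> = 0" "\<one>\<^bsub>poly_ring2 K\<^esub> = 1"
  by (simp_all add: poly_ring2_def ring_of_type_algebra_def)

lemma poly_ring2_uminus [simp]: "\<ominus>\<^bsub>poly_ring2 K\<^esub> r = - r"
  by (rule P.minus_equality) simp_all

text \<open>As \<open>k[x\<^sub>1, x\<^sub>2]\<close> is \<open>k[x\<^sub>1][x\<^sub>2]\<close>, everything divisible by \<open>x\<^sub>2\<close> goes into \<open>q\<close>; what is left is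
  a polynomial in \<open>x\<^sub>1\<close> without constant term.\<close>

lemma zero_constant_coeff_decomp:
  fixes p :: "'k::field poly poly"
  assumes "poly.coeff (poly.coeff p 0) 0 = 0"
  obtains a q where "p = xvar 1 * [:a:] + xvar 2 * q"
proof -
  obtain a0 q where p: "p = pCons a0 q" by (cases p)
  obtain c a where a0: "a0 = pCons c a" by (cases a0)
  have "p = xvar 1 * [:a:] + xvar 2 * q" using assms by (simp add: p a0 xvar_def)
  then show ?thesis by (rule that)
qed

lemma ideal_rel_ideal: "ideal (rel_ideal K) (poly_ring2 K)"
  unfolding rel_ideal_def by (rule P.genideal_ideal) simp

text \<open>The relations generate all monomials of degree at least two, so their ideal consists of the
  polynomials whose coefficients at \<open>1\<close>, \<open>x\<^sub>1\<close> and \<open>x\<^sub>2\<close> vanish. Thus membership is a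
  condition on three coefficients, and all facts about the quotient ring rest on it.\<close>

lemma rel_ideal_iff:
  "p \<in> rel_ideal K \<longleftrightarrow> poly.coeff (poly.coeff p 0) 0 = 0 \<and>
     poly.coeff (poly.coeff p 0) 1 = 0 \<and> poly.coeff (poly.coeff p 1) 0 = 0"
  (is "_ \<longleftrightarrow> ?low p")
proof
  let ?gens = "{xvar 1 ^ 2, xvar 1 * xvar 2, xvar 2 ^ 2} :: 'a poly poly set"
  have "ideal {p. ?low p} (poly_ring2 K)"
  proof (rule idealI)
    show "ring (poly_ring2 K)" by (rule P.ring_axioms)
    show "subgroup {p. ?low p} (add_monoid (poly_ring2 K))"
      by (rule P.add.subgroupI) (auto simp: a_inv_def[symmetric] intro: exI[of _ 0])
  qed (auto simp: coeff_mult)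
  moreover have "?gens \<subseteq> {p. ?low p}"
    by (auto simp: xvar_def coeff_mult power2_eq_square numeral_2_eq_2)
  ultimately have "rel_ideal K \<subseteq> {p. ?low p}"
    unfolding rel_ideal_def by (rule P.genideal_minimal)
  then show "p \<in> rel_ideal K \<Longrightarrow> ?low p" by blast
next
  assume low: "?low p"
  let ?gens = "{xvar 1 ^ 2, xvar 1 * xvar 2, xvar 2 ^ 2} :: 'a poly poly set"
  interpret I: ideal "rel_ideal K" "poly_ring2 K"
    by (rule ideal_rel_ideal)
  have gens: "?gens \<subseteq> rel_ideal K"
    unfolding rel_ideal_def by (rule P.genideal_self) simp
  obtain a0 p1 where p: "p = pCons a0 p1" by (cases p)
  obtain b0 q where p1: "p1 = pCons b0 q" by (cases p1)
  obtain c a1 where a0: "a0 = pCons c a1" by (cases a0)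
  obtain c' a where a1: "a1 = pCons c' a" by (cases a1)
  obtain c'' b where b0: "b0 = pCons c'' b" by (cases b0)
  \<comment> \<open>The monomials with \<open>x\<^sub>1\<^sup>2\<close> but no \<open>x\<^sub>2\<close>, those with exactly one \<open>x\<^sub>2\<close>, and the rest.\<close>
  have "p = [:a:] * xvar 1 ^ 2 + ([:b:] * (xvar 1 * xvar 2) + q * xvar 2 ^ 2)"
    using low by (simp add: p p1 a0 a1 b0 xvar_def power2_eq_square)
  moreover have "[:a:] * xvar 1 ^ 2 \<in> rel_ideal K" "[:b:] * (xvar 1 * xvar 2) \<in> rel_ideal K"
    "q * xvar 2 ^ 2 \<in> rel_ideal K"
    using gens I.I_l_closed[of "xvar 1 ^ 2" "[:a:]"]
      I.I_l_closed[of "xvar 1 * xvar 2" "[:b:]"] I.I_l_closed[of "xvar 2 ^ 2" q] by auto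
  ultimately show "p \<in> rel_ideal K" using I.a_closed by auto
qed

interpretation R: cring "R_ring K" for K :: "'k::field itself"
  unfolding R_ring_def by (rule ideal.quotient_is_cring[OF ideal_rel_ideal cring_poly_ring2])

abbreviation residue :: "'k::field itself \<Rightarrow> 'k poly poly \<Rightarrow> 'k poly poly set" where
  "residue K p \<equiv> rel_ideal K +>\<^bsub>poly_ring2 K\<^esub> p"

lemma residue_closed [simp]: "residue K p \<in> carrier (R_ring K)"
  using ring_hom_closed[OF ideal.rcos_ring_hom[OF ideal_rel_ideal], of p K] by (simp add: R_ring_def)

lemma residue_surj:
  assumes "r \<in> carrier (R_ring K)"
  obtains p where "r = residue K p"
  using assms that by (auto simp: R_ring_def FactRing_def A_RCOSETS_def')

lemma residue_add: "residue K p \<oplus>\<^bsub>R_ring K\<^esub> residue K q = residue K (p + q)"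
  using ring_hom_add[OF ideal.rcos_ring_hom[OF ideal_rel_ideal], of p K q] by (simp add: R_ring_def)

lemma residue_mult: "residue K p \<otimes>\<^bsub>R_ring K\<^esub> residue K q = residue K (p * q)"
  using ring_hom_mult[OF ideal.rcos_ring_hom[OF ideal_rel_ideal], of p K q] by (simp add: R_ring_def)

lemma residue_eq_zero_iff: "residue K p = \<zero>\<^bsub>R_ring K\<^esub> \<longleftrightarrow> p \<in> rel_ideal K"
  using ideal.rcos_const_imp_mem[OF ideal_rel_ideal, of p K] P.a_rcos_zero[OF ideal_rel_ideal, of p]
  by (auto simp: R_ring_def FactRing_def)

lemma R_ring_nontrivial: "\<one>\<^bsub>R_ring K\<^esub> \<noteq> \<zero>\<^bsub>R_ring K\<^esub>"
proof -
  have "\<one>\<^bsub>R_ring K\<^esub> = residue K 1"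
    using ring_hom_one[OF ideal.rcos_ring_hom[OF ideal_rel_ideal], of K] by (simp add: R_ring_def)
  then show ?thesis by (simp add: residue_eq_zero_iff rel_ideal_iff)
qed

lemma xbar_closed [simp]: "xbar K i \<in> carrier (R_ring K)"
  by (simp add: xbar_def)

lemma xvar_mult_in_rel_ideal:
  assumes "i \<in> {1, 2}" "j \<in> {1, 2}"
  shows "xvar i * xvar j \<in> rel_ideal K"
  using assms by (auto simp: rel_ideal_iff xvar_def)

lemma xbar_mult_xbar:
  "i \<in> {1, 2} \<Longrightarrow> j \<in> {1, 2} \<Longrightarrow> xbar K i \<otimes>\<^bsub>R_ring K\<^esub> xbar K j = \<zero>\<^bsub>R_ring K\<^esub>"
  unfolding xbar_def residue_mult residue_eq_zero_iff by (rule xvar_mult_in_rel_ideal)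

text \<open>The ideal \<open>(x\<^sub>1, x\<^sub>2)\<close> of the quotient ring. In positive degrees, the cycles and the boundaries
  both turn out to be the vectors with entries in it.\<close>

definition max_ideal :: "'k::field itself \<Rightarrow> 'k poly poly set set" where
  "max_ideal K = {xbar K 1 \<otimes>\<^bsub>R_ring K\<^esub> a \<oplus>\<^bsub>R_ring K\<^esub> xbar K 2 \<otimes>\<^bsub>R_ring K\<^esub> b | a b.
     a \<in> carrier (R_ring K) \<and> b \<in> carrier (R_ring K)}"

lemma residue_in_max_ideal:
  assumes "poly.coeff (poly.coeff p 0) 0 = 0"
  shows "residue K p \<in> max_ideal K"
proof -
  obtain a q where "p = xvar 1 * [:a:] + xvar 2 * q"
    using zero_constant_coeff_decomp[OF assms] .
  then have "residue K p = xbar K 1 \<otimes>\<^bsub>R_ring K\<^esub> residue K [:a:]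
      \<oplus>\<^bsub>R_ring K\<^esub> xbar K 2 \<otimes>\<^bsub>R_ring K\<^esub> residue K q"
    by (simp add: xbar_def residue_add residue_mult)
  then show ?thesis unfolding max_ideal_def using residue_closed by blast
qed

lemma xbar_mult_max_ideal:
  assumes "i \<in> {1, 2}" and "a \<in> max_ideal K"
  shows "xbar K i \<otimes>\<^bsub>R_ring K\<^esub> a = \<zero>\<^bsub>R_ring K\<^esub>"
proof -
  obtain b c where bc: "b \<in> carrier (R_ring K)" "c \<in> carrier (R_ring K)"
    "a = xbar K 1 \<otimes>\<^bsub>R_ring K\<^esub> b \<oplus>\<^bsub>R_ring K\<^esub> xbar K 2 \<otimes>\<^bsub>R_ring K\<^esub> c"
    using assms(2) by (auto simp: max_ideal_def)
  have "xbar K i \<otimes>\<^bsub>R_ring K\<^esub> a = (xbar K i \<otimes>\<^bsub>R_ring K\<^esub> xbar K 1) \<otimes>\<^bsub>R_ring K\<^esub> b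
      \<oplus>\<^bsub>R_ring K\<^esub> (xbar K i \<otimes>\<^bsub>R_ring K\<^esub> xbar K 2) \<otimes>\<^bsub>R_ring K\<^esub> c"
    using bc by (simp add: R.r_distr R.m_assoc)
  also have "\<dots> = \<zero>\<^bsub>R_ring K\<^esub>"
    using bc assms(1) by (simp add: xbar_mult_xbar)
  finally show ?thesis .
qed

text \<open>This is the whole algebra behind exactness. Since \<open>x\<^sub>1\<close> and \<open>x\<^sub>2\<close> are linearly independent over
  \<open>k\<close> and are annihilated by \<open>(x\<^sub>1, x\<^sub>2)\<close>, a relation \<open>x\<^sub>1a + x\<^sub>2b = 0\<close> says that the constant terms
  of \<open>a\<close> and \<open>b\<close> both vanish: the two summands cannot cancel each other.\<close>

lemma syzygy_iff:
  assumes "a \<in> carrier (R_ring K)" and "b \<in> carrier (R_ring K)"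
  shows "xbar K 1 \<otimes>\<^bsub>R_ring K\<^esub> a \<oplus>\<^bsub>R_ring K\<^esub> xbar K 2 \<otimes>\<^bsub>R_ring K\<^esub> b = \<zero>\<^bsub>R_ring K\<^esub>
    \<longleftrightarrow> a \<in> max_ideal K \<and> b \<in> max_ideal K"
proof
  assume eq: "xbar K 1 \<otimes>\<^bsub>R_ring K\<^esub> a \<oplus>\<^bsub>R_ring K\<^esub> xbar K 2 \<otimes>\<^bsub>R_ring K\<^esub> b = \<zero>\<^bsub>R_ring K\<^esub>"
  obtain p q where pq: "a = residue K p" "b = residue K q"
    using assms residue_surj by metis
  have "xvar 1 * p + xvar 2 * q \<in> rel_ideal K"
    using eq by (simp add: pq xbar_def residue_add residue_mult residue_eq_zero_iff)
  \<comment> \<open>In \<open>x\<^sub>1p + x\<^sub>2q\<close> the coefficients at \<open>x\<^sub>1\<close> and \<open>x\<^sub>2\<close> are the constant terms of \<open>p\<close> and \<open>q\<close>.\<close>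
  then have "poly.coeff (poly.coeff p 0) 0 = 0" "poly.coeff (poly.coeff q 0) 0 = 0"
    by (simp_all add: rel_ideal_iff xvar_def)
  then show "a \<in> max_ideal K \<and> b \<in> max_ideal K"
    by (simp add: pq residue_in_max_ideal)
next
  assume "a \<in> max_ideal K \<and> b \<in> max_ideal K"
  then show "xbar K 1 \<otimes>\<^bsub>R_ring K\<^esub> a \<oplus>\<^bsub>R_ring K\<^esub> xbar K 2 \<otimes>\<^bsub>R_ring K\<^esub> b = \<zero>\<^bsub>R_ring K\<^esub>"
    by (simp add: xbar_mult_max_ideal)
qed

lemma xbar1_mult_eq_zero_iff:
  assumes "a \<in> carrier (R_ring K)"
  shows "xbar K 1 \<otimes>\<^bsub>R_ring K\<^esub> a = \<zero>\<^bsub>R_ring K\<^esub> \<longleftrightarrow> a \<in> max_ideal K"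
proof -
  have "\<zero>\<^bsub>R_ring K\<^esub> \<in> max_ideal K"
    using syzygy_iff[of "\<zero>\<^bsub>R_ring K\<^esub>" K "\<zero>\<^bsub>R_ring K\<^esub>"] by simp
  then show ?thesis using syzygy_iff[OF assms, of "\<zero>\<^bsub>R_ring K\<^esub>"] assms by simp
qed

section \<open>The tree of vertices\<close>

text \<open>A vertex of positive degree has exactly one outgoing arrow, which leads to its parent and
  carries its label. Hence vertices and arrows can be exchanged, and the vertices form a tree. The
  vertex \<open>Bottom\<close> has no outgoing arrow; its parent and label are junk values.\<close>

fun parent :: "vertex \<Rightarrow> vertex" where
  "parent (New a j) = fst a"
| "parent v = Bottom"

fun label :: "vertex \<Rightarrow> nat" where
  "label (New a j) = j"
| "label v = 1"

text \<open>The first argument of \<open>New\<close> is the arrow being completed, here the only one that leaves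
  \<open>v\<close>.\<close>

definition child :: "vertex \<Rightarrow> nat \<Rightarrow> vertex" where
  "child v j = New (v, parent v, label v) j"

lemma child_simps [simp]:
  "parent (child v j) = v" "label (child v j) = j" "child v j = child w l \<longleftrightarrow> v = w \<and> j = l"
  by (auto simp: child_def)

lemma arrows_eq:
  "arrows (rel_ideal K) xvar n = (\<lambda>v. (v, parent v, label v)) ` verts K (Suc n)"
  by (cases n) (force simp: verts_def)+

lemma label_in: "v \<in> verts K (Suc n) \<Longrightarrow> label v \<in> {1, 2}"
  by (cases n) (auto simp: verts_def)

lemma verts_0 [simp]: "verts K 0 = {Bottom}"
  by (simp add: verts_def)

lemma verts_1 [simp]: "verts K (Suc 0) = {Initial}"
  by (simp add: verts_def)

text \<open>All products of two variables are relations, so from degree 1 on every vertex receives one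
  child for each of the two labels.\<close>

lemma verts_Suc_Suc:
  "verts K (Suc (Suc n)) = (\<lambda>(v, j). child v j) ` (verts K (Suc n) \<times> {1, 2})"
proof -
  have "verts K (Suc (Suc n)) = {New (v, parent v, label v) j | v j.
      v \<in> verts K (Suc n) \<and> j \<in> {1, 2} \<and> xvar (label v) * xvar j \<in> rel_ideal K}"
    by (auto simp: verts_def arrows_eq[unfolded verts_def])
  also have "\<dots> = {child v j | v j. v \<in> verts K (Suc n) \<and> j \<in> {1, 2}}"
    using xvar_mult_in_rel_ideal[OF label_in] by (auto simp: child_def) blast+
  finally show ?thesis by auto
qed

lemma finite_verts [simp]: "finite (verts K n)"
proof (induction n)
  case (Suc n)
  then show ?case by (cases n) (simp_all add: verts_Suc_Suc)
qed simp

lemma component_eq: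
  assumes "v \<in> verts K (Suc n)"
  shows "component K n v w = (if w = parent v then xbar K (label v) else \<zero>\<^bsub>R_ring K\<^esub>)"
proof -
  have "(v, w, i) \<in> arrows (rel_ideal K) xvar n \<longleftrightarrow> w = parent v \<and> i = label v" for w i
    using assms by (auto simp: arrows_eq)
  then show ?thesis by (simp add: component_def)
qed

text \<open>The vertices of degree \<open>n + 1\<close> are the leaves of a complete binary tree of height \<open>n\<close>; the
  binary digits of an index describe the path from \<open>Initial\<close> to the leaf.\<close>

fun vertex_at :: "nat \<Rightarrow> nat \<Rightarrow> vertex" where
  "vertex_at 0 i = Initial"
| "vertex_at (Suc n) i = child (vertex_at n (i div 2)) (1 + i mod 2)"

lemma bij_betw_vertex_at: "bij_betw (vertex_at n) {..<2 ^ n} (verts K (Suc n))"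
proof (induction n)
  case 0
  then show ?case by (auto simp: bij_betw_def inj_on_def)
next
  case (Suc n)
  have "inj_on (vertex_at (Suc n)) {..<2 ^ Suc n}"
  proof (rule inj_onI)
    fix i j :: nat
    assume ij: "i \<in> {..<2 ^ Suc n}" "j \<in> {..<2 ^ Suc n}"
      and eq: "vertex_at (Suc n) i = vertex_at (Suc n) j"
    have "i div 2 = j div 2"
      by (rule inj_onD[OF bij_betw_imp_inj_on[OF Suc]]) (use ij eq in auto)
    moreover have "i mod 2 = j mod 2" using eq by simp
    ultimately show "i = j" by (metis div_mult_mod_eq)
  qed
  moreover have "vertex_at (Suc n) ` {..<2 ^ Suc n} = verts K (Suc (Suc n))"
  proof (intro equalityI subsetI)
    fix v assume "v \<in> vertex_at (Suc n) ` {..<2 ^ Suc n}"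
    then obtain i where i: "i < 2 ^ Suc n" "v = vertex_at (Suc n) i" by auto
    then have "vertex_at n (i div 2) \<in> verts K (Suc n)"
      by (intro bij_betw_apply[OF Suc]) auto
    moreover have "1 + i mod 2 \<in> {1, 2}" by auto
    ultimately show "v \<in> verts K (Suc (Suc n))"
      unfolding i verts_Suc_Suc by auto
  next
    fix v assume "v \<in> verts K (Suc (Suc n))"
    then obtain w j where wj: "w \<in> verts K (Suc n)" "j \<in> {1, 2}" "v = child w j"
      by (auto simp: verts_Suc_Suc)
    then obtain i where i: "i < 2 ^ n" "w = vertex_at n i"
      using Suc by (auto simp: bij_betw_def)
    have "v = vertex_at (Suc n) (2 * i + (j - 1))" "2 * i + (j - 1) < 2 ^ Suc n"
      using wj i by auto
    then show "v \<in> vertex_at (Suc n) ` {..<2 ^ Suc n}" by blast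
  qed
  ultimately show ?case by (simp only: bij_betw_def)
qed

section \<open>The differential and its kernel and image\<close>

lemma V_carrier: "carrier (V K n) = verts K n \<rightarrow>\<^sub>E carrier (R_ring K)"
  by (auto simp: V_def free_on_def)

lemma component_closed [simp]:
  "v \<in> verts K (Suc n) \<Longrightarrow> component K n v w \<in> carrier (R_ring K)"
  by (simp add: component_eq)

lemma bd_hom: "bd K (Suc n) \<in> module_homs (R_ring K) (V K (Suc n)) (V K n)"
proof -
  have *: "bd K (Suc n) f \<in> carrier (V K n)" if "f \<in> carrier (V K (Suc n))" for f
    using that by (auto simp: bd_def V_carrier PiE_iff intro!: R.finsum_closed)
  moreover have "bd K (Suc n) (f \<oplus>\<^bsub>V K (Suc n)\<^esub> g) = bd K (Suc n) f \<oplus>\<^bsub>V K n\<^esub> bd K (Suc n) g"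
    if "f \<in> carrier (V K (Suc n))" "g \<in> carrier (V K (Suc n))" for f g
  proof
    fix w
    let ?c = "\<lambda>v. component K n v w"
    have fg: "f v \<in> carrier (R_ring K)" "g v \<in> carrier (R_ring K)" if "v \<in> verts K (Suc n)" for v
      using \<open>f \<in> _\<close> \<open>g \<in> _\<close> that by (auto simp: V_carrier)
    have "(\<Oplus>\<^bsub>R_ring K\<^esub>v \<in> verts K (Suc n). ?c v \<otimes>\<^bsub>R_ring K\<^esub> (f \<oplus>\<^bsub>V K (Suc n)\<^esub> g) v)
        = (\<Oplus>\<^bsub>R_ring K\<^esub>v \<in> verts K (Suc n).
            ?c v \<otimes>\<^bsub>R_ring K\<^esub> f v \<oplus>\<^bsub>R_ring K\<^esub> ?c v \<otimes>\<^bsub>R_ring K\<^esub> g v)"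
      using fg by (intro R.finsum_cong') (auto simp: V_def free_on_def R.r_distr)
    also have "\<dots> = (\<Oplus>\<^bsub>R_ring K\<^esub>v \<in> verts K (Suc n). ?c v \<otimes>\<^bsub>R_ring K\<^esub> f v)
        \<oplus>\<^bsub>R_ring K\<^esub> (\<Oplus>\<^bsub>R_ring K\<^esub>v \<in> verts K (Suc n). ?c v \<otimes>\<^bsub>R_ring K\<^esub> g v)"
      using fg by (intro R.finsum_addf) auto
    finally show "bd K (Suc n) (f \<oplus>\<^bsub>V K (Suc n)\<^esub> g) w
        = (bd K (Suc n) f \<oplus>\<^bsub>V K n\<^esub> bd K (Suc n) g) w"
      by (auto simp: bd_def V_def free_on_def)
  qed
  moreover have "bd K (Suc n) (r \<odot>\<^bsub>V K (Suc n)\<^esub> f) = r \<odot>\<^bsub>V K n\<^esub> bd K (Suc n) f"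
    if r: "r \<in> carrier (R_ring K)" and "f \<in> carrier (V K (Suc n))" for r f
  proof
    fix w
    let ?c = "\<lambda>v. component K n v w"
    have f: "f v \<in> carrier (R_ring K)" if "v \<in> verts K (Suc n)" for v
      using \<open>f \<in> _\<close> that by (auto simp: V_carrier)
    have "(\<Oplus>\<^bsub>R_ring K\<^esub>v \<in> verts K (Suc n). ?c v \<otimes>\<^bsub>R_ring K\<^esub> (r \<odot>\<^bsub>V K (Suc n)\<^esub> f) v)
        = (\<Oplus>\<^bsub>R_ring K\<^esub>v \<in> verts K (Suc n). r \<otimes>\<^bsub>R_ring K\<^esub> (?c v \<otimes>\<^bsub>R_ring K\<^esub> f v))"
      using f r by (intro R.finsum_cong') (auto simp: V_def free_on_def R.m_lcomm)
    also have "\<dots> = r \<otimes>\<^bsub>R_ring K\<^esub> (\<Oplus>\<^bsub>R_ring K\<^esub>v \<in> verts K (Suc n). ?c v \<otimes>\<^bsub>R_ring K\<^esub> f v)"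
      using f r by (intro R.finsum_rdistr[symmetric]) auto
    finally show "bd K (Suc n) (r \<odot>\<^bsub>V K (Suc n)\<^esub> f) w = (r \<odot>\<^bsub>V K n\<^esub> bd K (Suc n) f) w"
      by (auto simp: bd_def V_def free_on_def)
  qed
  ultimately show ?thesis by (auto simp: module_homs_def)
qed

lemma bd_1_apply:
  assumes "f \<in> carrier (V K (Suc 0))"
  shows "bd K (Suc 0) f Bottom = xbar K 1 \<otimes>\<^bsub>R_ring K\<^esub> f Initial"
  using assms by (auto simp: bd_def component_eq V_carrier PiE_iff)

text \<open>Only the two children of \<open>w\<close> have an arrow to \<open>w\<close>. As different \<open>w\<close> have different children,
  the differential decouples into copies of \<open>(a, b) \<mapsto> x\<^sub>1a + x\<^sub>2b\<close>.\<close>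

lemma bd_Suc_Suc_apply:
  assumes f: "f \<in> carrier (V K (Suc (Suc n)))" and w: "w \<in> verts K (Suc n)"
  shows "bd K (Suc (Suc n)) f w = xbar K 1 \<otimes>\<^bsub>R_ring K\<^esub> f (child w 1)
    \<oplus>\<^bsub>R_ring K\<^esub> xbar K 2 \<otimes>\<^bsub>R_ring K\<^esub> f (child w 2)"
proof -
  have children: "child w 1 \<in> verts K (Suc (Suc n))" "child w 2 \<in> verts K (Suc (Suc n))"
    using w by (auto simp: verts_Suc_Suc)
  have fR: "f v \<in> carrier (R_ring K)" if "v \<in> verts K (Suc (Suc n))" for v
    using f that by (auto simp: V_carrier)
  have "bd K (Suc (Suc n)) f w
      = (\<Oplus>\<^bsub>R_ring K\<^esub>v \<in> verts K (Suc (Suc n)). component K (Suc n) v w \<otimes>\<^bsub>R_ring K\<^esub> f v)"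
    using w by (simp add: bd_def)
  also have "\<dots> = (\<Oplus>\<^bsub>R_ring K\<^esub>v \<in> {child w 1, child w 2}. xbar K (label v) \<otimes>\<^bsub>R_ring K\<^esub> f v)"
  proof (rule R.add.finprod_mono_neutral_cong_right)
    show "component K (Suc n) v w \<otimes>\<^bsub>R_ring K\<^esub> f v = \<zero>\<^bsub>R_ring K\<^esub>"
      if "v \<in> verts K (Suc (Suc n)) - {child w 1, child w 2}" for v
    proof -
      have "w \<noteq> parent v" using that by (auto simp: verts_Suc_Suc)
      then show ?thesis using that fR by (simp add: component_eq)
    qed
  qed (use children fR in \<open>auto simp: component_eq\<close>)
  also have "\<dots> = xbar K 1 \<otimes>\<^bsub>R_ring K\<^esub> f (child w 1)
      \<oplus>\<^bsub>R_ring K\<^esub> xbar K 2 \<otimes>\<^bsub>R_ring K\<^esub> f (child w 2)"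
    using children fR by simp
  finally show ?thesis .
qed

text \<open>The submodule \<open>(x\<^sub>1, x\<^sub>2)V\<^sub>n\<close> of \<open>V\<^sub>n\<close>, written in coordinates.\<close>

definition max_chains :: "'k::field itself \<Rightarrow> nat \<Rightarrow> (vertex \<Rightarrow> 'k poly poly set) set" where
  "max_chains K n = {g \<in> carrier (V K n). \<forall>w \<in> verts K n. g w \<in> max_ideal K}"

text \<open>In degree 1 a cycle is an annihilator of \<open>x\<^sub>1\<close>; in higher degrees a cycle consists of one
  relation \<open>x\<^sub>1a + x\<^sub>2b = 0\<close> for each vertex one degree lower. Both conditions say
  that the entries lie in \<open>(x\<^sub>1, x\<^sub>2)\<close>.\<close>

lemma kernel_bd: "a_kernel (V K (Suc n)) (V K n) (bd K (Suc n)) = max_chains K (Suc n)"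
proof -
  have "bd K (Suc n) f = \<zero>\<^bsub>V K n\<^esub> \<longleftrightarrow> (\<forall>v \<in> verts K (Suc n). f v \<in> max_ideal K)"
    if f: "f \<in> carrier (V K (Suc n))" for f
  proof -
    have fR: "f v \<in> carrier (R_ring K)" if "v \<in> verts K (Suc n)" for v
      using f that by (auto simp: V_carrier)
    have zero_iff: "bd K (Suc n) f = \<zero>\<^bsub>V K n\<^esub> \<longleftrightarrow>
        (\<forall>w \<in> verts K n. bd K (Suc n) f w = \<zero>\<^bsub>R_ring K\<^esub>)"
      by (auto simp: V_def free_on_def bd_def fun_eq_iff)
    show ?thesis
    proof (cases n)
      case 0
      then show ?thesis using zero_iff f fR by (simp add: bd_1_apply xbar1_mult_eq_zero_iff[simplified])
    next
      case (Suc m)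
      have "bd K (Suc n) f w = \<zero>\<^bsub>R_ring K\<^esub> \<longleftrightarrow>
          f (child w 1) \<in> max_ideal K \<and> f (child w 2) \<in> max_ideal K"
        if w: "w \<in> verts K n" for w
      proof -
        have "child w 1 \<in> verts K (Suc n)" "child w 2 \<in> verts K (Suc n)"
          using w by (auto simp: verts_Suc_Suc Suc)
        then show ?thesis
          using bd_Suc_Suc_apply[of f K m w] f w syzygy_iff[OF fR fR] by (simp add: Suc)
      qed
      then show ?thesis unfolding zero_iff by (auto simp: verts_Suc_Suc Suc)
    qed
  qed
  then show ?thesis by (auto simp: a_kernel_def' max_chains_def)
qed

text \<open>The entries \<open>x\<^sub>1a + x\<^sub>2b\<close> of a boundary run through \<open>(x\<^sub>1, x\<^sub>2)\<close> independently of each other,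
  because the children of different vertices are different.\<close>

lemma image_bd: "bd K (Suc (Suc n)) ` carrier (V K (Suc (Suc n))) = max_chains K (Suc n)"
proof (intro equalityI subsetI)
  fix g assume "g \<in> bd K (Suc (Suc n)) ` carrier (V K (Suc (Suc n)))"
  then obtain f where f: "f \<in> carrier (V K (Suc (Suc n)))" "g = bd K (Suc (Suc n)) f" by blast
  have "g w \<in> max_ideal K" if w: "w \<in> verts K (Suc n)" for w
  proof -
    have "f (child w j) \<in> carrier (R_ring K)" if "j \<in> {1, 2}" for j
      using f(1) w that by (auto simp: V_carrier verts_Suc_Suc PiE_iff)
    then show ?thesis
      using bd_Suc_Suc_apply[OF f(1) w] unfolding f(2) max_ideal_def by blast
  qed
  moreover have "g \<in> carrier (V K (Suc n))"
    using bd_hom[of K "Suc n"] f by (auto simp: module_homs_def)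
  ultimately show "g \<in> max_chains K (Suc n)" by (simp add: max_chains_def)
next
  fix g assume g: "g \<in> max_chains K (Suc n)"
  then have "\<forall>w \<in> verts K (Suc n). \<exists>a b. a \<in> carrier (R_ring K) \<and> b \<in> carrier (R_ring K) \<and>
      g w = xbar K 1 \<otimes>\<^bsub>R_ring K\<^esub> a \<oplus>\<^bsub>R_ring K\<^esub> xbar K 2 \<otimes>\<^bsub>R_ring K\<^esub> b"
    unfolding max_chains_def max_ideal_def by blast
  then obtain a b where ab: "a w \<in> carrier (R_ring K)" "b w \<in> carrier (R_ring K)"
      "g w = xbar K 1 \<otimes>\<^bsub>R_ring K\<^esub> a w \<oplus>\<^bsub>R_ring K\<^esub> xbar K 2 \<otimes>\<^bsub>R_ring K\<^esub> b w"
    if "w \<in> verts K (Suc n)" for w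
    by metis
  define f where "f = (\<lambda>v \<in> verts K (Suc (Suc n)). if label v = 1 then a (parent v) else b (parent v))"
  have f: "f \<in> carrier (V K (Suc (Suc n)))"
    using ab by (auto simp: f_def V_carrier verts_Suc_Suc)
  have "bd K (Suc (Suc n)) f = g"
  proof (rule extensionalityI[of _ "verts K (Suc n)"])
    fix w assume w: "w \<in> verts K (Suc n)"
    then have "f (child w 1) = a w" "f (child w 2) = b w"
      by (auto simp: f_def verts_Suc_Suc)
    then show "bd K (Suc (Suc n)) f w = g w"
      using bd_Suc_Suc_apply[OF f w] ab[OF w] by simp
  qed (use g in \<open>auto simp: bd_def max_chains_def V_carrier PiE_def\<close>)
  then show "g \<in> bd K (Suc (Suc n)) ` carrier (V K (Suc (Suc n)))"
    using f by blast
qed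

section \<open>The augmentation\<close>

lemma ideal_x1_ideal: "ideal (x1_ideal K) (R_ring K)"
  unfolding x1_ideal_def by (rule R.genideal_ideal) simp

lemma x1_ideal_eq: "x1_ideal K = {xbar K 1 \<otimes>\<^bsub>R_ring K\<^esub> r | r. r \<in> carrier (R_ring K)}"
  unfolding x1_ideal_def R.cgenideal_eq_genideal[OF xbar_closed, symmetric] cgenideal_def
  using R.m_comm[OF _ xbar_closed, of _ K 1] by metis

lemma proj_hom:
  "proj K \<in> module_homs (R_ring K) (V K 0) (quotient_module (R_ring K) (x1_ideal K))"
proof -
  note hom = ideal.rcos_ring_hom[OF ideal_x1_ideal, of K]
  show ?thesis
    using ring_hom_closed[OF hom] ring_hom_add[OF hom] ring_hom_mult[OF hom]
    by (auto simp: module_homs_def proj_def quotient_module_def V_def free_on_def PiE_iff)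
qed

lemma proj_surj: "proj K ` carrier (V K 0) = carrier (quotient_module (R_ring K) (x1_ideal K))"
proof (intro equalityI subsetI)
  fix S assume "S \<in> carrier (quotient_module (R_ring K) (x1_ideal K))"
  then obtain r where r: "r \<in> carrier (R_ring K)" "S = x1_ideal K +>\<^bsub>R_ring K\<^esub> r"
    by (auto simp: quotient_module_def FactRing_def A_RCOSETS_def')
  then have "S = proj K (\<lambda>v\<in>{Bottom}. r)" "(\<lambda>v\<in>{Bottom}. r) \<in> carrier (V K 0)"
    by (auto simp: proj_def V_carrier)
  then show "S \<in> proj K ` carrier (V K 0)" by blast
qed (use proj_hom[of K] in \<open>auto simp: module_homs_def\<close>)

text \<open>Both sides consist of the vectors whose single entry is a multiple of \<open>x\<^sub>1\<close>.\<close>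

lemma image_bd_1:
  "bd K (Suc 0) ` carrier (V K (Suc 0)) =
     a_kernel (V K 0) (quotient_module (R_ring K) (x1_ideal K)) (proj K)"
proof -
  have "proj K g = \<zero>\<^bsub>quotient_module (R_ring K) (x1_ideal K)\<^esub> \<longleftrightarrow> g Bottom \<in> x1_ideal K"
    if "g \<in> carrier (V K 0)" for g
    using that ideal.rcos_const_imp_mem[OF ideal_x1_ideal, of "g Bottom"]
      R.a_rcos_zero[OF ideal_x1_ideal, of "g Bottom"]
    by (auto simp: proj_def quotient_module_def FactRing_def V_carrier PiE_iff)
  then have "a_kernel (V K 0) (quotient_module (R_ring K) (x1_ideal K)) (proj K)
      = {g \<in> carrier (V K 0). g Bottom \<in> x1_ideal K}"
    by (auto simp: a_kernel_def')
  also have "\<dots> = bd K (Suc 0) ` carrier (V K (Suc 0))"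
  proof (intro equalityI subsetI)
    fix g assume g: "g \<in> {g \<in> carrier (V K 0). g Bottom \<in> x1_ideal K}"
    then obtain r where r: "r \<in> carrier (R_ring K)" "g Bottom = xbar K 1 \<otimes>\<^bsub>R_ring K\<^esub> r"
      by (auto simp: x1_ideal_eq)
    let ?f = "\<lambda>v\<in>{Initial}. r"
    have f: "?f \<in> carrier (V K (Suc 0))" using r by (simp add: V_carrier)
    have "bd K (Suc 0) ?f = g"
    proof (rule extensionalityI[of _ "{Bottom}"])
      show "bd K (Suc 0) ?f w = g w" if "w \<in> {Bottom}" for w
        using that bd_1_apply[OF f] r by simp
    qed (use g in \<open>auto simp: bd_def V_carrier PiE_def\<close>)
    then show "g \<in> bd K (Suc 0) ` carrier (V K (Suc 0))" using f by blast
  next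
    fix g assume "g \<in> bd K (Suc 0) ` carrier (V K (Suc 0))"
    then obtain f where f: "f \<in> carrier (V K (Suc 0))" "g = bd K (Suc 0) f" by blast
    have "g \<in> carrier (V K 0)" using bd_hom[of K 0] f by (auto simp: module_homs_def)
    moreover have "g Bottom \<in> x1_ideal K"
      using f by (auto simp: bd_1_apply x1_ideal_eq V_carrier PiE_iff)
    ultimately show "g \<in> {g \<in> carrier (V K 0). g Bottom \<in> x1_ideal K}" by simp
  qed
  finally show ?thesis by simp
qed

lemma free_resolution_V:
  "free_resolution (R_ring K) (V K) (bd K) (quotient_module (R_ring K) (x1_ideal K)) (proj K)"
  unfolding free_resolution_def
proof (intro conjI allI impI)
  show "Module.module (R_ring K) (quotient_module (R_ring K) (x1_ideal K))"
    by (rule ideal.module_quotient_module[OF ideal_x1_ideal R.is_cring])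
  show "free_module (R_ring K) (V K n)" for n
    unfolding V_def by (rule R.free_module_free_on[OF R_ring_nontrivial])
  show "proj K \<in> module_homs (R_ring K) (V K 0) (quotient_module (R_ring K) (x1_ideal K))"
    by (rule proj_hom)
  show "proj K ` carrier (V K 0) = carrier (quotient_module (R_ring K) (x1_ideal K))"
    by (rule proj_surj)
  show "bd K 1 ` carrier (V K 1) =
      a_kernel (V K 0) (quotient_module (R_ring K) (x1_ideal K)) (proj K)"
    using image_bd_1 by simp
  fix n :: nat assume "n \<ge> 1"
  then obtain m where n: "n = Suc m" by (cases n) auto
  show "bd K n \<in> module_homs (R_ring K) (V K n) (V K (n - 1))"
    using bd_hom by (simp add: n)
  show "bd K (n + 1) ` carrier (V K (n + 1)) = a_kernel (V K n) (V K (n - 1)) (bd K n)"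
    using image_bd[of K m] kernel_bd[of K m] by (simp add: n)
qed

section \<open>The matrices\<close>

text \<open>With this order the two children of the \<open>i\<close>-th vertex stand at the positions \<open>2i\<close> and
  \<open>2i + 1\<close>, which produces the block form of the matrices.\<close>

definition vertex_list :: "nat \<Rightarrow> vertex list" where
  "vertex_list n = (if n = 0 then [Bottom] else map (vertex_at (n - 1)) [0..<2 ^ (n - 1)])"

lemma vertex_list_enumerates: "distinct (vertex_list n) \<and> set (vertex_list n) = verts K n"
proof (cases n)
  case 0
  then show ?thesis by (simp add: vertex_list_def)
next
  case (Suc m)
  then show ?thesis
    using bij_betw_vertex_at[of m K]
    by (simp add: vertex_list_def distinct_map bij_betw_def atLeast0LessThan)
qed

lemma bd_basis_vec:
  assumes v: "v \<in> verts K (Suc n)" and w: "w \<in> verts K n"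
  shows "bd K (Suc n) (basis_vec (R_ring K) (verts K (Suc n)) v) w = component K n v w"
proof -
  have "bd K (Suc n) (basis_vec (R_ring K) (verts K (Suc n)) v) w =
      (\<Oplus>\<^bsub>R_ring K\<^esub>u \<in> verts K (Suc n).
        component K n u w \<otimes>\<^bsub>R_ring K\<^esub> basis_vec (R_ring K) (verts K (Suc n)) v u)"
    using w by (simp add: bd_def)
  also have "\<dots> =
      (\<Oplus>\<^bsub>R_ring K\<^esub>u \<in> verts K (Suc n). if v = u then component K n u w else \<zero>\<^bsub>R_ring K\<^esub>)"
    by (intro R.finsum_cong') (auto simp: basis_vec_def)
  also have "\<dots> = component K n v w"
    using v by (intro R.finsum_singleton) auto
  finally show ?thesis .
qed

abbreviation bd_matrix :: "'k::field itself \<Rightarrow> nat \<Rightarrow> 'k poly poly set mat" where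
  "bd_matrix K n \<equiv> matrix_of (R_ring K) (vertex_list (n - 1)) (vertex_list n) (bd K n)"

lemma length_vertex_list: "length (vertex_list n) = 2 ^ (n - 1)"
  by (simp add: vertex_list_def)

lemma bd_matrix_index:
  assumes "i < length (vertex_list n)" and "j < length (vertex_list (Suc n))"
  shows "bd_matrix K (Suc n) $$ (i, j) =
    component K n (vertex_list (Suc n) ! j) (vertex_list n ! i)"
proof -
  have "vertex_list (Suc n) ! j \<in> verts K (Suc n)" "vertex_list n ! i \<in> verts K n"
    using assms vertex_list_enumerates nth_mem by metis+
  then show ?thesis
    using assms vertex_list_enumerates[of "Suc n" K] by (simp add: matrix_of_def bd_basis_vec)
qed

lemma bd_matrix_1: "bd_matrix K 1 = mat_of_rows_list 1 [[xbar K 1]]"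
proof (rule eq_matI)
  fix i j assume "i < dim_row (mat_of_rows_list 1 [[xbar K 1]])"
    "j < dim_col (mat_of_rows_list 1 [[xbar K 1]])"
  then show "bd_matrix K 1 $$ (i, j) = mat_of_rows_list 1 [[xbar K 1]] $$ (i, j)"
    using bd_matrix_index[of 0 0 0 K] component_eq[of Initial K 0]
    by (simp add: vertex_list_def mat_of_rows_list_def)
qed (simp_all add: matrix_of_def mat_of_rows_list_def vertex_list_def)

text \<open>A staircase of copies of the row \<open>[x\<^sub>1 x\<^sub>2]\<close>: the parent of the vertex at position \<open>j\<close> stands
  at position \<open>j div 2\<close>, and its label is determined by the parity of \<open>j\<close>.\<close>

lemma bd_matrix_Suc_Suc:
  "bd_matrix K (Suc (Suc n)) = mat (2 ^ n) (2 ^ Suc n)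
     (\<lambda>(i, j). if i = j div 2 then xbar K (1 + j mod 2) else \<zero>\<^bsub>R_ring K\<^esub>)"
  (is "_ = ?M")
proof (rule eq_matI)
  fix i j assume "i < dim_row ?M" "j < dim_col ?M"
  then have ij: "i < 2 ^ n" "j < 2 ^ Suc n" by simp_all
  have bij: "bij_betw (vertex_at m) {..<2 ^ m} (verts K (Suc m))" for m
    by (rule bij_betw_vertex_at)
  have "vertex_at (Suc n) j \<in> verts K (Suc (Suc n))"
    using ij by (intro bij_betw_apply[OF bij]) simp
  moreover have "vertex_at n i = vertex_at n (j div 2) \<longleftrightarrow> i = j div 2"
    using ij by (intro inj_on_eq_iff[OF bij_betw_imp_inj_on[OF bij]]) auto
  ultimately show "bd_matrix K (Suc (Suc n)) $$ (i, j) = ?M $$ (i, j)"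
    using ij bd_matrix_index[of i "Suc n" j K] component_eq[of "vertex_at (Suc n) j" K "Suc n"]
    by (simp add: vertex_list_def)
qed (simp_all add: matrix_of_def length_vertex_list)

lemma bd_matrix_2: "bd_matrix K 2 = mat_of_rows_list 2 [[xbar K 1, xbar K 2]]"
proof (rule eq_matI)
  let ?M = "mat_of_rows_list 2 [[xbar K 1, xbar K 2]]"
  have eq: "bd_matrix K 2 = mat 1 2
      (\<lambda>(i, j). if i = j div 2 then xbar K (1 + j mod 2) else \<zero>\<^bsub>R_ring K\<^esub>)"
    using bd_matrix_Suc_Suc[of K 0] by (simp add: numeral_2_eq_2)
  then show "dim_row (bd_matrix K 2) = dim_row ?M" "dim_col (bd_matrix K 2) = dim_col ?M"
    by (simp_all add: mat_of_rows_list_def)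
  fix i j assume "i < dim_row ?M" "j < dim_col ?M"
  then have "i = 0" "j = 0 \<or> j = 1" by (auto simp: mat_of_rows_list_def)
  then show "bd_matrix K 2 $$ (i, j) = ?M $$ (i, j)"
    unfolding eq by (auto simp: mat_of_rows_list_def numeral_2_eq_2)
qed

text \<open>The staircase is invariant under the shift by \<open>2\<^sup>k\<close> rows and \<open>2\<^sup>k\<^sup>+\<^sup>1\<close> columns. So its lower
  right quarter repeats the upper left one, and the other two quarters miss the staircase.\<close>

lemma bd_matrix_block:
  assumes "n \<ge> 3"
  shows "bd_matrix K n = (let D = bd_matrix K (n - 1);
      Z = zero_matrix (R_ring K) (dim_row D) (dim_col D) in four_block_mat D Z Z D)"
proof -
  define staircase where "staircase k = mat (2 ^ k) (2 ^ Suc k)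
    (\<lambda>(i, j). if i = j div 2 then xbar K (1 + j mod 2) else \<zero>\<^bsub>R_ring K\<^esub>)" for k
  let ?Z = "\<lambda>k. zero_matrix (R_ring K) (2 ^ k) (2 ^ Suc k)"
  have block: "staircase (Suc k) = four_block_mat (staircase k) (?Z k) (?Z k) (staircase k)" for k
  proof (rule eq_matI)
    fix i j
    assume "i < dim_row (four_block_mat (staircase k) (?Z k) (?Z k) (staircase k))"
      and "j < dim_col (four_block_mat (staircase k) (?Z k) (?Z k) (staircase k))"
    moreover have "(j - 2 ^ Suc k) div 2 = j div 2 - 2 ^ k \<and> (j - 2 ^ Suc k) mod 2 = j mod 2 \<and>
        2 ^ k \<le> j div 2"
      if ge: "2 ^ Suc k \<le> j"
    proof -
      obtain l where "j = 2 ^ Suc k + l" using le_Suc_ex[OF ge] by blast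
      then show ?thesis by simp
    qed
    moreover have "j div 2 < 2 ^ k" if "j < 2 ^ Suc k" using that by auto
    ultimately show "staircase (Suc k) $$ (i, j) =
        four_block_mat (staircase k) (?Z k) (?Z k) (staircase k) $$ (i, j)"
      by (cases "i < 2 ^ k"; cases "j < 2 ^ Suc k")
        (auto simp: staircase_def zero_matrix_def)
  qed (simp_all add: staircase_def zero_matrix_def)
  have bd_matrix_staircase: "bd_matrix K (Suc (Suc k)) = staircase k" for k
    using bd_matrix_Suc_Suc[of K k] by (simp only: staircase_def)
  define m where "m = n - 3"
  have n: "n = Suc (Suc (Suc m))" "n - 1 = Suc (Suc m)" using assms by (simp_all add: m_def)
  have D: "bd_matrix K n = staircase (Suc m)" "bd_matrix K (n - 1) = staircase m"
    using bd_matrix_staircase[of "Suc m"] bd_matrix_staircase[of m] by (simp_all only: n diff_Suc_1)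
  have "dim_row (staircase m) = 2 ^ m" "dim_col (staircase m) = 2 ^ Suc m"
    by (simp_all add: staircase_def)
  then show ?thesis using block[of m] unfolding D Let_def by simp
qed

theorem theorem12:
  fixes K :: "'k::field itself"
  shows "(\<exists>ord :: nat \<Rightarrow> vertex list.
       (\<forall>n. distinct (ord n) \<and> set (ord n) = verts K n) \<and>
       length (ord 0) = 1 \<and>
       (\<lambda>f. f (ord 0 ! 0)) \<in> module_isos (R_ring K) (V K 0) (regular_module (R_ring K)) \<and>
       (\<forall>n\<ge>1. length (ord n) = 2 ^ (n - 1) \<and>
          (\<lambda>f. \<lambda>i\<in>{1..2 ^ (n - 1)}. f (ord n ! (i - 1)))
            \<in> module_isos (R_ring K) (V K n) (free_on (R_ring K) {1..(2::nat) ^ (n - 1)})) \<and>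
       (let D = (\<lambda>n. matrix_of (R_ring K) (ord (n - 1)) (ord n) (bd K n)) in
          D 1 = mat_of_rows_list 1 [[xbar K 1]] \<and>
          D 2 = mat_of_rows_list 2 [[xbar K 1, xbar K 2]] \<and>
          (\<forall>n\<ge>3. D n =
             (let Z = zero_matrix (R_ring K) (dim_row (D (n - 1))) (dim_col (D (n - 1)))
              in four_block_mat (D (n - 1)) Z Z (D (n - 1)))))) \<and>
     free_resolution (R_ring K) (V K) (bd K)
       (quotient_module (R_ring K) (x1_ideal K)) (proj K)"
proof (rule conjI[OF exI[of _ vertex_list] free_resolution_V], unfold Let_def,
    intro conjI allI impI)
  show "distinct (vertex_list n)" "set (vertex_list n) = verts K n" for n
    using vertex_list_enumerates by auto
  show "length (vertex_list 0) = 1" by (simp add: vertex_list_def)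
  show "(\<lambda>f. f (vertex_list 0 ! 0)) \<in> module_isos (R_ring K) (V K 0) (regular_module (R_ring K))"
    using R.free_on_singleton_iso[of Bottom K] by (simp add: V_def vertex_list_def)
  show "length (vertex_list n) = 2 ^ (n - 1)" for n by (rule length_vertex_list)
  show "(\<lambda>f. \<lambda>i\<in>{1..2 ^ (n - 1)}. f (vertex_list n ! (i - 1)))
      \<in> module_isos (R_ring K) (V K n) (free_on (R_ring K) {1..(2::nat) ^ (n - 1)})" for n
  proof -
    have shift: "bij_betw (\<lambda>i. i - 1) {1..(2::nat) ^ (n - 1)} {..<length (vertex_list n)}"
      by (rule bij_betw_byWitness[where f' = Suc]) (auto simp: length_vertex_list)
    have nth: "bij_betw ((!) (vertex_list n)) {..<length (vertex_list n)} (verts K n)"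
      using vertex_list_enumerates by (intro bij_betw_nth) auto
    have "bij_betw (\<lambda>i. vertex_list n ! (i - 1)) {1..(2::nat) ^ (n - 1)} (verts K n)"
      by (rule bij_betw_trans[OF shift nth, unfolded comp_def])
    then show ?thesis
      unfolding V_def by (rule R.free_on_reindex_iso)
  qed
  show "bd_matrix K 1 = mat_of_rows_list 1 [[xbar K 1]]" by (rule bd_matrix_1)
  show "bd_matrix K 2 = mat_of_rows_list 2 [[xbar K 1, xbar K 2]]" by (rule bd_matrix_2)
  show "bd_matrix K n = four_block_mat (bd_matrix K (n - 1))
      (zero_matrix (R_ring K) (dim_row (bd_matrix K (n - 1))) (dim_col (bd_matrix K (n - 1))))
      (zero_matrix (R_ring K) (dim_row (bd_matrix K (n - 1))) (dim_col (bd_matrix K (n - 1))))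
      (bd_matrix K (n - 1))" if "n \<ge> 3" for n
    using bd_matrix_block[OF that] by (simp only: Let_def)
qed

end
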